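(* Let $m,n\ge1$, let $G=G_{m\times n}$, let $d=\gcd(m+1,n+1)$ and let $v=(a,b)$ be a vertex of $G$. If $d\nmid a$ and $d\nmid b$, then $(G,v)$ is a P-position in the Undirected Edge Geography game.
   Context: $G_{m\times n}=P_m\square P_n$ is the grid graph with vertex set $[m]\times[n]$, $(i,j)\sim(i',j')$ iff $|i-i'|+|j-j'|=1$. Undirected Edge Geography is a two-player game on a rooted graph: a position is $(H,v)$ with $v$ the root; a move chooses an edge of $H$ incident to $v$, deletes it, and makes its other endpoint the new root; players alternate and the first player unable to move loses. A position is an N-position if the player to move has a winning strategy, and a P-position otherwise (the player to move loses under optimal play). *)

theory Defs
  imports Main
begin

text \<open>A simple graph is a pair of a vertex set and a set of two-element vertex sets.\<close>

type_synonym 'a graph = "'a set \<times> 'a set set"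

definition vertices :: "'a graph \<Rightarrow> 'a set" where
  "vertices G = fst G"

definition grid_graph :: "nat \<Rightarrow> nat \<Rightarrow> (nat \<times> nat) graph" where
  "grid_graph m n =
    ({1..m} \<times> {1..n},
     {{(i, j), (i', j')} | i j i' j'.
        (i, j) \<in> {1..m} \<times> {1..n} \<and> (i', j') \<in> {1..m} \<times> {1..n} \<and>
        \<bar>int i - int i'\<bar> + \<bar>int j - int j'\<bar> = 1})"

type_synonym 'a position = "'a graph \<times> 'a"

inductive geography_move :: "'a position \<Rightarrow> 'a position \<Rightarrow> bool" where
  "{v, w} \<in> E \<Longrightarrow> geography_move ((V, E), v) ((V, E - {{v, w}}), w)"

definition terminal :: "'a position \<Rightarrow> bool" where
  "terminal p \<longleftrightarrow> (\<nexists>q. geography_move p q)"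

text \<open>A play from \<open>p\<close> is the nonempty list of all positions visited so far, \<open>p\<close> included.
  Hence the player who moves first is to move exactly when the list has odd length.\<close>

definition play :: "'a position \<Rightarrow> 'a position list \<Rightarrow> bool" where
  "play p ps \<longleftrightarrow> ps \<noteq> [] \<and> hd ps = p \<and> successively geography_move ps"

text \<open>A strategy of the first player maps each play in which that player has to move to the next
  position; it may depend on the whole history. Its values on other lists are irrelevant.\<close>

definition first_player_strategy ::
  "'a position \<Rightarrow> ('a position list \<Rightarrow> 'a position) \<Rightarrow> bool" where
  "first_player_strategy p \<sigma> \<longleftrightarrow>
    (\<forall>ps. play p ps \<and> odd (length ps) \<and> \<not> terminal (last ps) \<longrightarrow>
       geography_move (last ps) (\<sigma> ps))"

definition follows :: "('a position list \<Rightarrow> 'a position) \<Rightarrow> 'a position list \<Rightarrow> bool" where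
  "follows \<sigma> ps \<longleftrightarrow>
    (\<forall>i. even i \<and> Suc i < length ps \<longrightarrow> ps ! Suc i = \<sigma> (take (Suc i) ps))"

text \<open>The player unable to move loses, so the first player wins a completed play iff its list of
  positions has even length. Each move deletes an edge, so on a finite graph every play can be
  continued to a completed one in boundedly many moves; the definitions below are meant for
  finite graphs only.\<close>

definition winning_strategy ::
  "'a position \<Rightarrow> ('a position list \<Rightarrow> 'a position) \<Rightarrow> bool" where
  "winning_strategy p \<sigma> \<longleftrightarrow>
    first_player_strategy p \<sigma> \<and>
    (\<forall>ps. play p ps \<and> follows \<sigma> ps \<and> terminal (last ps) \<longrightarrow> even (length ps))"

definition N_position :: "'a position \<Rightarrow> bool" where
  "N_position p \<longleftrightarrow> (\<exists>\<sigma>. winning_strategy p \<sigma>)"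

definition P_position :: "'a position \<Rightarrow> bool" where
  "P_position p \<longleftrightarrow> \<not> N_position p"

end

theory Submission
  imports Defs
begin

text \<open>The second player wins from every vertex of an even kernel \<open>S\<close>, i.e. an independent set such
  that every vertex outside \<open>S\<close> has an even number of neighbours in \<open>S\<close>: after a move out of \<open>S\<close>
  an odd number of edges back into \<open>S\<close> remains, and using one of them restores the invariant.
  For every \<open>g\<close> on the integers, \<open>f(i, j) = g(i + j) + g(i - j)\<close> has even neighbourhood sums on
  the infinite grid. If \<open>g\<close> is even and \<open>2d\<close>-periodic, \<open>f\<close> is even on the lines \<open>d | i\<close> and
  \<open>d | j\<close>, in particular around the \<open>m\<close> by \<open>n\<close> grid. The indicator of \<open>\<plusminus>(a + b)\<close> modulo \<open>2d\<close>
  makes the support of \<open>f\<close> modulo 2 an even kernel, which contains \<open>(a, b)\<close> because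
  \<open>a - b\<close> is congruent to neither of \<open>\<plusminus>(a + b)\<close> modulo \<open>2d\<close>.\<close>

section \<open>Even kernels and the second player's reply\<close>

definition even_kernel :: "'a set set \<Rightarrow> 'a set \<Rightarrow> bool" where
  "even_kernel E S \<longleftrightarrow>
    (\<forall>u\<in>S. \<forall>v\<in>S. {u, v} \<notin> E) \<and> (\<forall>w. w \<notin> S \<longrightarrow> even (card {u \<in> S. {w, u} \<in> E}))"

text \<open>The old root \<open>v\<close> is one of evenly many neighbours of \<open>w\<close> in
  \<open>S\<close>, so a second one, \<open>u\<close>, exists. Deleting both edges lowers the count
  at \<open>w\<close> by two; their other ends lie in \<open>S\<close>, so no other count
  changes.\<close>

lemma even_kernel_reply:
  assumes K: "even_kernel E S" and fin: "finite E" and v: "v \<in> S" and e: "{v, w} \<in> E"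
  obtains u where "u \<in> S" "{w, u} \<in> E - {{v, w}}" "even_kernel (E - {{v, w}} - {{w, u}}) S"
proof -
  let ?N = "\<lambda>E x. {u \<in> S. {x, u} \<in> E}"
  have w: "w \<notin> S"
    using K v e by (auto simp: even_kernel_def)
  have finN: "finite (?N E w)"
  proof (rule inj_on_finite)
    show "inj_on (\<lambda>u. {w, u}) (?N E w)"
      by (auto simp: inj_on_def doubleton_eq_iff)
    show "(\<lambda>u. {w, u}) ` ?N E w \<subseteq> E"
      by auto
  qed (rule fin)
  have vN: "v \<in> ?N E w"
    using v e by (simp add: insert_commute)
  have ev: "even (card (?N E w))"
    using K w by (simp add: even_kernel_def)
  have "?N E w \<noteq> {v}"
    using ev by auto
  then obtain u where u: "u \<in> ?N E w" "u \<noteq> v"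
    using vN by blast
  have "even (card (?N (E - {{v, w}} - {{w, u}}) x))" if x: "x \<notin> S" for x
  proof (cases "x = w")
    case True
    have "?N (E - {{v, w}} - {{w, u}}) w = ?N E w - {v, u}"
      using v w u by (auto simp: doubleton_eq_iff)
    moreover have "card (?N E w - {v, u}) = card (?N E w) - 2"
      using vN u by (subst card_Diff_subset) auto
    ultimately show ?thesis
      using ev True by simp
  next
    case False
    then have "?N (E - {{v, w}} - {{w, u}}) x = ?N E x"
      using v u x by (auto simp: doubleton_eq_iff)
    then show ?thesis
      using K x by (simp add: even_kernel_def)
  qed
  then have "even_kernel (E - {{v, w}} - {{w, u}}) S"
    using K by (simp add: even_kernel_def)
  moreover have "{w, u} \<in> E - {{v, w}}"
    using u by (auto simp: doubleton_eq_iff)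
  ultimately show thesis
    using that u by blast
qed

lemma play_snoc:
  assumes "play p ps" and "geography_move (last ps) q"
  shows "play p (ps @ [q])"
  using assms by (auto simp: play_def successively_append_iff)

text \<open>Only odd indices are bound by \<sigma>. The length being odd, \<open>\<sigma> ps\<close>
  lands on such an index and \<open>q\<close>, the opponent's free choice, on an even one.\<close>

lemma follows_strategy_move:
  assumes "follows \<sigma> ps" and "odd (length ps)"
  shows "follows \<sigma> (ps @ [\<sigma> ps, q])"
  unfolding follows_def
proof (intro allI impI, elim conjE)
  fix i
  assume i: "even i" "Suc i < length (ps @ [\<sigma> ps, q])"
  have "i \<noteq> length ps"
    using i(1) assms(2) by auto
  then consider "Suc i < length ps" | "Suc i = length ps"
    using i(2) by fastforce
  then show "(ps @ [\<sigma> ps, q]) ! Suc i = \<sigma> (take (Suc i) (ps @ [\<sigma> ps, q]))"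
    using assms(1) i(1) by cases (auto simp: follows_def nth_append)
qed

text \<open>A winning \<sigma> never gets stuck after a play of odd length, yet replies into
  \<open>S\<close> keep producing longer such plays with fewer edges. Induction on
  \<open>card F\<close> makes this descent a contradiction.\<close>

lemma even_kernel_P_position:
  assumes "even_kernel E S" and "finite E" and "v \<in> S"
  shows "P_position ((V, E), v)"
proof (unfold P_position_def N_position_def, rule notI, elim exE)
  fix \<sigma>
  assume win: "winning_strategy ((V, E), v) \<sigma>"
  let ?p = "((V, E), v)"
  have False
    if "play ?p ps" "follows \<sigma> ps" "odd (length ps)" "last ps = ((V, F), x)"
      "even_kernel F S" "finite F" "x \<in> S" for ps F x
    using that
  proof (induction "card F" arbitrary: ps F x rule: less_induct)
    case less
    have nt: "\<not> terminal (last ps)"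
      using win less.prems by (auto simp: winning_strategy_def)
    then have "geography_move ((V, F), x) (\<sigma> ps)"
      using win less.prems by (auto simp: winning_strategy_def first_player_strategy_def)
    then obtain w where w: "{x, w} \<in> F" "\<sigma> ps = ((V, F - {{x, w}}), w)"
      by cases auto
    obtain u where u: "u \<in> S" "{w, u} \<in> F - {{x, w}}"
      "even_kernel (F - {{x, w}} - {{w, u}}) S"
      using even_kernel_reply less.prems w by metis
    let ?F = "F - {{x, w}} - {{w, u}}"
    let ?ps = "ps @ [\<sigma> ps, ((V, ?F), u)]"
    have "play ?p (ps @ [\<sigma> ps])"
      using less.prems w by (intro play_snoc) (simp_all add: geography_move.intros)
    moreover have "geography_move (\<sigma> ps) ((V, ?F), u)"
      unfolding w(2) using u(2) by (rule geography_move.intros)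
    ultimately have "play ?p ((ps @ [\<sigma> ps]) @ [((V, ?F), u)])"
      by (metis play_snoc last_snoc)
    then have "play ?p ?ps"
      by simp
    moreover have "card ?F < card F"
      using less.prems w by (intro psubset_card_mono) auto
    moreover have "follows \<sigma> ?ps"
      using less.prems by (intro follows_strategy_move)
    ultimately show False
      using less.hyps[of ?F ?ps u] less.prems u by simp
  qed
  from this[of "[?p]" E v] assms show False
    by (simp add: play_def follows_def)
qed

section \<open>Even kernels in the grid\<close>

lemma finite_grid_edges: "finite (snd (grid_graph m n))"
proof (rule finite_subset)
  show "snd (grid_graph m n) \<subseteq> Pow ({1..m} \<times> {1..n})"
    by (auto simp: grid_graph_def)
qed simp

lemma grid_edge_iff:
  "{(i, j), (k, l)} \<in> snd (grid_graph m n) \<longleftrightarrow>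
    (i, j) \<in> {1..m} \<times> {1..n} \<and> (k, l) \<in> {1..m} \<times> {1..n} \<and>
    \<bar>int i - int k\<bar> + \<bar>int j - int l\<bar> = 1"
  (is "?L \<longleftrightarrow> ?R")
proof
  assume ?L
  then obtain i' j' k' l' where *: "{(i, j), (k, l)} = {(i', j'), (k', l')}"
    "(i', j') \<in> {1..m} \<times> {1..n}" "(k', l') \<in> {1..m} \<times> {1..n}"
    "\<bar>int i' - int k'\<bar> + \<bar>int j' - int l'\<bar> = 1"
    unfolding grid_graph_def by auto
  from *(1) show ?R
    unfolding doubleton_eq_iff using *(2-) by auto
next
  assume ?R
  then show ?L
    unfolding grid_graph_def by auto
qed

text \<open>On truth values \<open>\<noteq>\<close> is addition modulo 2. Points outside the grid
  are included, so that the border lines can be treated like the others.\<close>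

definition diagonal_sum_support :: "(int \<Rightarrow> bool) \<Rightarrow> (nat \<times> nat) set" where
  "diagonal_sum_support g = {(i, j). g (int i + int j) \<noteq> g (int i - int j)}"

lemma even_kernel_diagonal_sum_support:
  assumes refl: "\<And>x. g (- x) = g x"
    and period_m: "\<And>x. g (x + 2 * (int m + 1)) = g x"
    and period_n: "\<And>x. g (x + 2 * (int n + 1)) = g x"
    and parity: "\<And>x y. g x \<Longrightarrow> g y \<Longrightarrow> even (x - y)"
  shows "even_kernel (snd (grid_graph m n)) (diagonal_sum_support g)"
    (is "even_kernel ?E ?S")
  unfolding even_kernel_def
proof (intro conjI ballI allI impI)
  fix u v
  assume uv: "u \<in> ?S" "v \<in> ?S"
  obtain i j k l where [simp]: "u = (i, j)" "v = (k, l)"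
    by fastforce
  \<comment> \<open>Since \<open>i + j\<close> and \<open>i - j\<close> have equal parity,
    \<open>parity\<close> puts all of \<open>S\<close> on one chessboard colour, whereas edges join
    opposite colours.\<close>
  have "even (int i + int j - (int k + int l))"
    using uv parity[of "int i + int j" "int k + int l"] parity[of "int i + int j" "int k - int l"]
      parity[of "int i - int j" "int k + int l"] parity[of "int i - int j" "int k - int l"]
    by (auto simp: diagonal_sum_support_def)
  then have "even (\<bar>int i - int k\<bar> + \<bar>int j - int l\<bar>)"
    by auto
  then have "\<bar>int i - int k\<bar> + \<bar>int j - int l\<bar> \<noteq> 1"
    by (metis odd_one)
  then show "{u, v} \<notin> ?E"
    by (simp add: grid_edge_iff)
next
  fix w :: "nat \<times> nat"
  obtain i j where w: "w = (i, j)"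
    by fastforce
  show "even (card {u \<in> ?S. {w, u} \<in> ?E})"
  proof (cases "w \<in> {1..m} \<times> {1..n}")
    case False
    then have "{u \<in> ?S. {w, u} \<in> ?E} = {}"
      by (auto simp: w grid_edge_iff)
    then show ?thesis
      by (simp only: card.empty even_zero)
  next
    case True
    then have ij: "1 \<le> i" "i \<le> m" "1 \<le> j" "j \<le> n"
      by (auto simp: w)
    \<comment> \<open>The support misses the border lines, so passing to the infinite grid adds no
      neighbours in \<open>S\<close>.\<close>
    have in_grid: "1 \<le> k \<and> k \<le> m \<and> 1 \<le> l \<and> l \<le> n"
      if "(k, l) \<in> ?S" "k \<le> m + 1" "l \<le> n + 1" for k l
    proof -
      have "(0, l) \<notin> ?S" "(k, 0) \<notin> ?S"
        by (simp_all add: diagonal_sum_support_def refl)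
      \<comment> \<open>On row \<open>m + 1\<close> the two arguments are negatives of each other
        modulo \<open>2 * (m + 1)\<close>; on column \<open>n + 1\<close> they differ by one
        period.\<close>
      moreover have "(m + 1, l) \<notin> ?S"
        using refl[of "int m + 1 - int l"] period_m[of "int l - (int m + 1)"]
        by (simp add: diagonal_sum_support_def algebra_simps)
      moreover have "(k, n + 1) \<notin> ?S"
        using period_n[of "int k - (int n + 1)"]
        by (simp add: diagonal_sum_support_def algebra_simps)
      ultimately have "k \<noteq> 0" "l \<noteq> 0" "k \<noteq> m + 1" "l \<noteq> n + 1"
        using that(1) by metis+
      then show ?thesis
        using that by auto
    qed
    \<comment> \<open>As \<open>i\<close> and \<open>j\<close> are positive, the truncated
      subtractions are exact.\<close>
    let ?nbrs = "[(i - 1, j), (i + 1, j), (i, j - 1), (i, j + 1)]"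
    have nbr: "\<bar>int i - int k\<bar> + \<bar>int j - int l\<bar> = 1 \<longleftrightarrow> (k, l) \<in> set ?nbrs" for k l
      using ij by auto
    have "{u \<in> ?S. {w, u} \<in> ?E} = set (filter (\<lambda>u. u \<in> ?S) ?nbrs)"
    proof (rule set_eqI)
      fix u :: "nat \<times> nat"
      obtain k l where u: "u = (k, l)"
        by fastforce
      have "k \<le> m + 1 \<and> l \<le> n + 1" if "u \<in> set ?nbrs"
        using that ij by (auto simp: u)
      then have "u \<in> ?S \<Longrightarrow> u \<in> set ?nbrs \<Longrightarrow> 1 \<le> k \<and> k \<le> m \<and> 1 \<le> l \<and> l \<le> n"
        using in_grid[of k l] u by blast
      moreover have "{w, u} \<in> ?E \<longleftrightarrow>
          (1 \<le> k \<and> k \<le> m \<and> 1 \<le> l \<and> l \<le> n) \<and> u \<in> set ?nbrs"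
        unfolding w u grid_edge_iff nbr using ij by auto
      ultimately show "u \<in> {u \<in> ?S. {w, u} \<in> ?E} \<longleftrightarrow> u \<in> set (filter (\<lambda>u. u \<in> ?S) ?nbrs)"
        unfolding set_filter mem_Collect_eq by blast
    qed
    moreover have "distinct ?nbrs"
      using ij by auto
    ultimately have "card {u \<in> ?S. {w, u} \<in> ?E} = length (filter (\<lambda>u. u \<in> ?S) ?nbrs)"
      by (simp only: distinct_card distinct_filter)
    moreover have "even (length (filter (\<lambda>u. u \<in> ?S) ?nbrs))"
    proof -
      \<comment> \<open>A grid step changes both \<open>s\<close> and \<open>t\<close> by one, and
        each of the values of \<open>g\<close> at \<open>s - 1\<close>, \<open>s + 1\<close>,
        \<open>t - 1\<close>, \<open>t + 1\<close> enters exactly two of the four memberships, so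
        they cancel modulo 2.\<close>
      define s t where "s = int i + int j" and "t = int i - int j"
      have "(i - 1, j) \<in> ?S \<longleftrightarrow> g (s - 1) \<noteq> g (t - 1)"
        "(i + 1, j) \<in> ?S \<longleftrightarrow> g (s + 1) \<noteq> g (t + 1)"
        "(i, j - 1) \<in> ?S \<longleftrightarrow> g (s - 1) \<noteq> g (t + 1)"
        "(i, j + 1) \<in> ?S \<longleftrightarrow> g (s + 1) \<noteq> g (t - 1)"
        using ij by (simp_all add: diagonal_sum_support_def s_def t_def of_nat_diff algebra_simps)
      then show ?thesis
        by simp
    qed
    ultimately show ?thesis
      by simp
  qed
qed

theorem theorem2p7:
  fixes m n d a b :: nat and G :: "(nat \<times> nat) graph" and v :: "nat \<times> nat"
  assumes "m \<ge> 1" and "n \<ge> 1"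
    and "G = grid_graph m n"
    and "d = gcd (m + 1) (n + 1)"
    and "v = (a, b)" and "v \<in> vertices G"
    and "\<not> d dvd a" and "\<not> d dvd b"
  shows "P_position (G, v)"
proof -
  define c where "c = int a + int b"
  define g where "g x \<longleftrightarrow> 2 * int d dvd x - c \<or> 2 * int d dvd x + c" for x
  have g_refl: "g (- x) = g x" for x
  proof -
    have "- x - c = - (x + c)" "- x + c = - (x - c)"
      by simp_all
    then show ?thesis
      unfolding g_def by (metis dvd_minus_iff)
  qed
  have g_period: "g (x + 2 * (int k + 1)) = g x" if "d dvd k + 1" for x k
  proof -
    from that have "int d dvd int (k + 1)"
      unfolding of_nat_dvd_iff .
    then have "2 * int d dvd 2 * (int k + 1)"
      by (intro mult_dvd_mono) (auto simp: add.commute)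
    then have "2 * int d dvd y + 2 * (int k + 1) \<longleftrightarrow> 2 * int d dvd y" for y
      by (simp add: dvd_add_left_iff)
    from this[of "x - c"] this[of "x + c"] show ?thesis
      by (simp add: g_def algebra_simps)
  qed
  have g_parity: "even (x - y)" if "g x" "g y" for x y
  proof -
    \<comment> \<open>The modulus \<open>2 * d\<close> is even, so either sign gives
      \<open>z\<close> the parity of \<open>c\<close>.\<close>
    have "even (z - c)" if "g z" for z
      using that unfolding g_def by (auto dest: dvd_mult_left)
    from this[OF that(1)] this[OF that(2)] show ?thesis
      by auto
  qed
  have "even_kernel (snd G) (diagonal_sum_support g)"
    unfolding assms(3)
  proof (rule even_kernel_diagonal_sum_support)
    show "g (x + 2 * (int m + 1)) = g x" "g (x + 2 * (int n + 1)) = g x" for x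
      by (simp_all only: g_period assms(4) gcd_dvd1 gcd_dvd2)
  qed (fact g_refl, fact g_parity)
  moreover have "v \<in> diagonal_sum_support g"
  proof -
    \<comment> \<open>Cancelling the factor 2, membership of \<open>a - b\<close> in the residues of
      \<open>c\<close> and \<open>- c\<close> would mean \<open>d dvd b\<close> or
      \<open>d dvd a\<close>.\<close>
    have eqs: "int a - int b - c = 2 * (- int b)" "int a - int b + c = 2 * int a"
      by (simp_all add: c_def)
    have "\<not> g (int a - int b)"
      unfolding g_def eqs using assms(7,8) by simp
    moreover have "g (int a + int b)"
      by (simp add: g_def c_def)
    ultimately show ?thesis
      by (simp add: diagonal_sum_support_def assms(5))
  qed
  ultimately have "P_position ((fst G, snd G), v)"
    using finite_grid_edges assms(3) by (intro even_kernel_P_position) auto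
  then show ?thesis
    by simp
qed

end
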